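(* Let $G$ be an infinite planar group satisfying the ascending and descending chain conditions on subgroups. Then $G$ has no element of order $pqr$ for distinct primes $p,q,r$.
   Context: For a group $G$, the subgroup graph $\mathcal{L}(G)$ is the graph whose vertices are all subgroups of $G$, two subgroups $H,K$ being adjacent if one of them is a maximal subgroup of the other. $G$ is planar if $\mathcal{L}(G)$ is a planar graph. *)

theory Defs
  imports "HOL-Analysis.Analysis" "HOL-Algebra.Algebra" "HOL-Computational_Algebra.Primes"
begin

definition planar_graph :: "'v set \<Rightarrow> 'v set set \<Rightarrow> bool" where
  "planar_graph V E \<longleftrightarrow>
     (\<exists>(f :: 'v \<Rightarrow> complex) (\<gamma> :: 'v set \<Rightarrow> real \<Rightarrow> complex).
        inj_on f V \<and>
        (\<forall>e\<in>E. arc (\<gamma> e) \<and> {pathstart (\<gamma> e), pathfinish (\<gamma> e)} = f ` e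
                 \<and> path_image (\<gamma> e) \<inter> f ` V = f ` e) \<and>
        (\<forall>e\<in>E. \<forall>e'\<in>E. e \<noteq> e' \<longrightarrow>
                 path_image (\<gamma> e) \<inter> path_image (\<gamma> e') \<subseteq> f ` (e \<inter> e')))"

definition maximal_subgroup_of :: "('a, 'b) monoid_scheme \<Rightarrow> 'a set \<Rightarrow> 'a set \<Rightarrow> bool" where
  "maximal_subgroup_of G H K \<longleftrightarrow>
     subgroup H G \<and> subgroup K G \<and> H \<subset> K \<and>
     (\<forall>L. subgroup L G \<and> H \<subseteq> L \<and> L \<subseteq> K \<longrightarrow> L = H \<or> L = K)"

definition subgroup_graph_vertices :: "('a, 'b) monoid_scheme \<Rightarrow> 'a set set" where
  "subgroup_graph_vertices G = {H. subgroup H G}"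

definition subgroup_graph_edges :: "('a, 'b) monoid_scheme \<Rightarrow> 'a set set set" where
  "subgroup_graph_edges G =
     {{H, K} | H K. maximal_subgroup_of G H K \<or> maximal_subgroup_of G K H}"

definition planar_group :: "('a, 'b) monoid_scheme \<Rightarrow> bool" where
  "planar_group G \<longleftrightarrow> planar_graph (subgroup_graph_vertices G) (subgroup_graph_edges G)"

definition subgroup_acc :: "('a, 'b) monoid_scheme \<Rightarrow> bool" where
  "subgroup_acc G \<longleftrightarrow> (\<forall>F :: nat \<Rightarrow> 'a set.
     (\<forall>n. subgroup (F n) G) \<and> (\<forall>n. F n \<subseteq> F (Suc n)) \<longrightarrow> (\<exists>N. \<forall>n\<ge>N. F n = F N))"

definition subgroup_dcc :: "('a, 'b) monoid_scheme \<Rightarrow> bool" where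
  "subgroup_dcc G \<longleftrightarrow> (\<forall>F :: nat \<Rightarrow> 'a set.
     (\<forall>n. subgroup (F n) G) \<and> (\<forall>n. F (Suc n) \<subseteq> F n) \<longrightarrow> (\<exists>N. \<forall>n\<ge>N. F n = F N))"

end

theory Submission
  imports Defs
begin

text \<open>
  A theta curve has no complementary point from which all three of its open arcs are accessible, so
  no planar graph contains a subdivided \<open>K\<^sub>3\<^sub>,\<^sub>3\<close>.  Suppose \<open>ord x = p q r\<close>.  The subgroups of
  \<open>\<langle>x\<rangle>\<close> form a cube in the subgroup graph.  An element \<open>y\<close> of prime order outside \<open>\<langle>x\<rangle>\<close> would
  provide a walk from \<open>1\<close> through \<open>\<langle>y\<rangle>\<close> and \<open>G\<close> down to \<open>\<langle>x\<rangle>\<close>, joining two antipodes of the cube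
  outside it, and a cube with such a walk contains a subdivided \<open>K\<^sub>3\<^sub>,\<^sub>3\<close>.  Hence all elements of
  prime order lie in \<open>\<langle>x\<rangle>\<close>, which is therefore normal.

  Choose \<open>\<langle>d\<rangle> \<supseteq> \<langle>x\<rangle>\<close> maximal among the normal cyclic subgroups.  The centralizer of \<open>d\<close> has finite
  index, so it is infinite and contains some \<open>y\<close> outside \<open>\<langle>d\<rangle>\<close>; since \<open>\<langle>d\<rangle>\<close> contains all elements
  of prime order, this yields a prime \<open>s\<close> dividing \<open>ord d\<close> and an \<open>e\<close> with \<open>e\<^sup>s = d\<close>.  By
  maximality some conjugate \<open>e'\<close> of \<open>e\<close> is not in \<open>\<langle>e\<rangle>\<close>.  If \<open>t\<close>, \<open>u\<close> are the other two of the
  three primes, then the subgroups of index \<open>1\<close>, \<open>t\<close>, \<open>u\<close> in each of \<open>\<langle>e\<rangle>\<close>, \<open>\<langle>e'\<rangle>\<close> and \<open>\<langle>d\<^sup>s\<rangle>\<close>,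
  together with those in \<open>\<langle>d\<rangle>\<close>, again form a subdivided \<open>K\<^sub>3\<^sub>,\<^sub>3\<close>.
\<close>

subsection \<open>Planar graphs and \<open>K\<^sub>3\<^sub>,\<^sub>3\<close>\<close>

definition theta_arcs :: "complex \<Rightarrow> complex \<Rightarrow> (nat \<Rightarrow> real \<Rightarrow> complex) \<Rightarrow> bool" where
  "theta_arcs a b c \<longleftrightarrow>
     (\<forall>i<3. arc (c i) \<and> pathstart (c i) = a \<and> pathfinish (c i) = b) \<and>
     (\<forall>i<3. \<forall>j<3. i \<noteq> j \<longrightarrow> path_image (c i) \<inter> path_image (c j) = {a, b})"

text \<open>Running along \<open>c\<close> and back along \<open>d\<close> gives a simple closed
  curve with image \<open>J\<close>, to which the Jordan curve theorem applies.\<close>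

lemma Jordan_arc_pair:
  fixes c d :: "real \<Rightarrow> complex"
  assumes "arc c" "arc d" "pathstart c = a" "pathfinish c = b" "pathstart d = a" "pathfinish d = b"
    and "path_image c \<inter> path_image d = {a, b}"
  defines "J \<equiv> path_image c \<union> path_image d"
  shows "inside J \<noteq> {}" "connected (inside J)" "connected (outside J)"
    "frontier (inside J) = J" "frontier (outside J) = J"
proof -
  have J: "path_image (c +++ reversepath d) = J"
    using assms by (simp add: path_image_join)
  have "simple_path (c +++ reversepath d)"
    using assms by (intro simple_path_join_loop) (auto simp: arc_reversepath)
  moreover have "pathfinish (c +++ reversepath d) = pathstart (c +++ reversepath d)"
    using assms by simp
  ultimately show "inside J \<noteq> {}" "connected (inside J)" "connected (outside J)"
    "frontier (inside J) = J" "frontier (outside J) = J"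
    using Jordan_inside_outside[of "c +++ reversepath d"] unfolding J by auto
qed

lemma theta_arcsD:
  assumes "theta_arcs a b c" "i < 3" "j < 3" "i \<noteq> j"
  defines "J \<equiv> path_image (c i) \<union> path_image (c j)"
  shows "inside J \<noteq> {}" "connected (inside J)" "connected (outside J)"
    "frontier (inside J) = J" "frontier (outside J) = J"
proof -
  have "arc (c i)" "arc (c j)" "pathstart (c i) = a" "pathfinish (c i) = b"
    "pathstart (c j) = a" "pathfinish (c j) = b" "path_image (c i) \<inter> path_image (c j) = {a, b}"
    using assms(1-4) unfolding theta_arcs_def by simp_all
  from Jordan_arc_pair[OF this] show "inside J \<noteq> {}" "connected (inside J)" "connected (outside J)"
    "frontier (inside J) = J" "frontier (outside J) = J"
    unfolding J_def by simp_all
qed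

text \<open>Otherwise the insides of the three cycles are pairwise disjoint. A point inside the
  cycle of arcs 0 and 1 then lies outside both other cycles, and Janiszewski's theorem joins it to a
  point outside the whole curve without crossing that curve, which is absurd.\<close>

lemma theta_some_arc_inside:
  assumes th: "theta_arcs a b c"
  shows "\<exists>i<3. \<exists>j<3. \<exists>k<3. i \<noteq> j \<and> j \<noteq> k \<and> i \<noteq> k \<and>
           path_image (c k) \<inter> inside (path_image (c i) \<union> path_image (c j)) \<noteq> {}"
proof (rule ccontr)
  assume none: "\<not> ?thesis"
  define J where "J i j = path_image (c i) \<union> path_image (c j)" for i j
  define T where "T = J 0 2 \<union> J 1 2"
  have J: "inside (J i j) \<noteq> {}" "connected (inside (J i j))" "connected (outside (J i j))"
    "frontier (inside (J i j)) = J i j" if "i < 3" "j < 3" "i \<noteq> j" for i j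
    using theta_arcsD[OF th that] unfolding J_def by blast+
  have comm: "J i j = J j i" for i j by (auto simp: J_def)
  \<comment> \<open>\<open>inside (J i j)\<close> is connected and misses \<open>J i k\<close>, the
    frontier of \<open>inside (J i k)\<close>, so once it meets that region it cannot leave
    it.\<close>
  have sub: "inside (J i j) \<subseteq> inside (J i k)"
    if "i < 3" "j < 3" "k < 3" "i \<noteq> j" "i \<noteq> k" "j \<noteq> k"
      "inside (J i j) \<inter> inside (J i k) \<noteq> {}" for i j k
  proof -
    have "path_image (c k) \<inter> inside (J i j) = {}"
      using none that unfolding J_def by blast
    moreover have "inside (J i j) \<inter> J i j = {}"
      by (simp add: inside_no_overlap)
    ultimately have "J i k \<inter> inside (J i j) = {}"
      unfolding J_def by blast
    then show ?thesis
      using connected_Int_frontier[OF J(2)[OF that(1,2,4)] that(7)] J(4)[OF that(1,3,5)] by blast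
  qed
  \<comment> \<open>By \<open>sub\<close> in both directions, overlapping insides coincide, and so
    do their frontiers. The arc \<open>c j\<close> would then be covered by the other two and
    consist of its endpoints only.\<close>
  have disj: "inside (J i j) \<inter> inside (J i k) = {}"
    if "i < 3" "j < 3" "k < 3" "i \<noteq> j" "i \<noteq> k" "j \<noteq> k" for i j k
  proof (rule ccontr)
    assume "inside (J i j) \<inter> inside (J i k) \<noteq> {}"
    then have "inside (J i j) = inside (J i k)"
      using sub[of i j k] sub[of i k j] that by blast
    then have "J i j = J i k" using J that by metis
    then have "path_image (c j) \<subseteq> path_image (c i) \<union> path_image (c k)" by (auto simp: J_def)
    moreover have "path_image (c i) \<inter> path_image (c j) = {a, b}" "path_image (c j) \<inter> path_image (c k) = {a, b}"
      using th that unfolding theta_arcs_def by simp_all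
    ultimately have "path_image (c j) \<subseteq> {a, b}" by blast
    moreover have "path_image (c j) - {a, b} \<noteq> {}"
      using th that nonempty_simple_path_endless[of "c j"] unfolding theta_arcs_def
      by (metis arc_imp_simple_path)
    ultimately show False by blast
  qed
  obtain x where x: "x \<in> inside (J 0 1)" using J[of 0 1] by auto
  have cpt: "compact (J i j)" if "i < 3" "j < 3" for i j
    using th that unfolding theta_arcs_def J_def by (simp add: compact_Un compact_arc_image)
  have "bounded T" using cpt by (auto simp: T_def compact_imp_bounded)
  then obtain y where y: "y \<in> outside T" using outside_bounded_nonempty by blast
  have cc: "connected_component (- J i 2) x y" if "i < 2" for i
  proof -
    have "x \<notin> inside (J i 2)"
    proof (cases "i = 0")
      case True
      then show ?thesis using disj[of 0 1 2] x by auto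
    next
      case False
      then show ?thesis using disj[of 1 0 2] x comm[of 1 0] that by (auto simp: less_2_cases_iff)
    qed
    moreover have "x \<notin> J i 2"
    proof
      assume "x \<in> J i 2"
      moreover have "x \<notin> J 0 1" using x inside_no_overlap by blast
      ultimately have "x \<in> path_image (c 2)" using that by (auto simp: J_def less_2_cases_iff)
      moreover have "path_image (c 2) \<inter> inside (J 0 1) = {}"
        using none[simplified, rule_format, of 0 1 2] unfolding J_def by simp
      ultimately show False using x by blast
    qed
    ultimately have "x \<in> outside (J i 2)" by (simp add: outside_inside)
    moreover have "y \<in> outside (J i 2)"
      using y outside_mono[of "J i 2" T] that by (auto simp: T_def less_2_cases_iff)
    moreover have "connected (outside (J i 2))" using J that by simp
    moreover have "outside (J i 2) \<subseteq> - J i 2" by (simp add: outside_no_overlap disjoint_eq_subset_Compl[symmetric])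
    ultimately show ?thesis unfolding connected_component_def by blast
  qed
  have "path_image (c 0) \<inter> path_image (c 1) = {a, b}" "path_image (c 0) \<inter> path_image (c 2) = {a, b}"
    using th unfolding theta_arcs_def by simp_all
  then have "J 0 2 \<inter> J 1 2 = path_image (c 2)"
    unfolding J_def by blast
  \<comment> \<open>Janiszewski's theorem asks that the two closed sets have a connected
    intersection; here it is the shared arc.\<close>
  then have "connected (J 0 2 \<inter> J 1 2)"
    using th by (auto simp: theta_arcs_def intro!: connected_path_image arc_imp_path)
  then have "connected_component (- T) x y"
    unfolding T_def using cpt cc by (intro Janiszewski) (auto intro: compact_imp_closed)
  then have "connected_component (- J 0 1) x y"
    by (rule connected_component_of_subset) (auto simp: T_def J_def)
  then have "y \<in> inside (J 0 1)" using x by (rule inside_same_component)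
  moreover have "y \<in> outside (J 0 1)" using y outside_mono[of "J 0 1" T] by (auto simp: T_def J_def)
  ultimately show False by (simp add: outside_inside)
qed

text \<open>The complement of the curve consists of the outside of one cycle and the two pieces into
  which the third arc cuts its inside. Each of these regions is bounded by two arcs only, so a
  connected set from \<open>z\<close> to the remaining arc would have to touch one of those
  two.\<close>

lemma theta_no_common_access:
  assumes th: "theta_arcs a b c"
    and w: "\<And>i. i < 3 \<Longrightarrow> w i \<in> path_image (c i) - {a, b}"
    and Q: "\<And>i. i < 3 \<Longrightarrow> connected (Q i)" "\<And>i. i < 3 \<Longrightarrow> z \<in> Q i" "\<And>i. i < 3 \<Longrightarrow> w i \<in> Q i"
    and QT: "\<And>i j. i < 3 \<Longrightarrow> j < 3 \<Longrightarrow> Q i \<inter> path_image (c j) \<subseteq> {w i}"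
  shows False
proof -
  obtain i j k where ijk: "i < 3" "j < 3" "k < 3" "i \<noteq> j" "j \<noteq> k" "i \<noteq> k"
    and ne: "path_image (c k) \<inter> inside (path_image (c i) \<union> path_image (c j)) \<noteq> {}"
    using theta_some_arc_inside[OF th] by blast
  define J where "J i j = path_image (c i) \<union> path_image (c j)" for i j
  have J: "frontier (inside (J m n)) = J m n" "frontier (outside (J m n)) = J m n"
    if "m < 3" "n < 3" "m \<noteq> n" for m n
    using theta_arcsD[OF th that] unfolding J_def by blast+
  have spl: "inside (J i k) \<union> inside (J j k) \<union> (path_image (c k) - {a, b}) = inside (J i j)"
  proof (rule split_inside_simple_closed_curve[of "c i" a b "c j" "c k"])
    show "a \<noteq> b" using th ijk unfolding theta_arcs_def by (metis arc_distinct_ends)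
  qed (use th ijk ne in \<open>auto simp: theta_arcs_def J_def arc_imp_simple_path\<close>)
  have wn: "w m \<notin> path_image (c n)" if "m < 3" "n < 3" "m \<noteq> n" for m n
    using w[of m] th that unfolding theta_arcs_def by blast
  have z: "z \<notin> path_image (c n)" if "n < 3" for n
  proof
    assume *: "z \<in> path_image (c n)"
    have "z = w i" "z = w j" using * Q(2) QT that ijk by blast+
    then show False using wn[of i j] w[of j] ijk by auto
  qed
  \<comment> \<open>\<open>Q l\<close> leads from \<open>z\<close> in \<open>U\<close> to
    \<open>w l\<close> outside \<open>U\<close>, so it meets the frontier \<open>J m n\<close>; but
    \<open>w l\<close> is the only point of the curve that \<open>Q l\<close> may contain, and it
    lies on neither arc.\<close>
  have acc: "z \<notin> U" if U: "frontier U = J m n" and "l < 3" "m < 3" "n < 3" "l \<noteq> m" "l \<noteq> n" "w l \<notin> U" for U l m n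
  proof
    assume "z \<in> U"
    then have "Q l \<inter> J m n \<noteq> {}"
      using connected_Int_frontier[of "Q l" U] Q that by blast
    then have "w l \<in> J m n" using QT that unfolding J_def by blast
    then show False using wn that unfolding J_def by blast
  qed
  have no: "inside (J i j) \<inter> J i j = {}" by (simp add: inside_no_overlap)
  have "w i \<notin> inside (J i j)" "w j \<notin> inside (J i j)"
    using w[of i] w[of j] ijk no unfolding J_def by blast+
  then have "w i \<notin> inside (J j k)" "w j \<notin> inside (J i k)" using spl by blast+
  then have "z \<notin> inside (J j k)" "z \<notin> inside (J i k)"
    using acc[OF J(1)] ijk by metis+
  then have "z \<in> outside (J i j)"
    using spl z ijk by (auto simp: outside_inside J_def)
  moreover have "w k \<notin> outside (J i j)"
    using spl w[of k] ijk by (auto simp: outside_inside)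
  ultimately show False using acc[OF J(2)] ijk by metis
qed

text \<open>The arcs from \<open>B 1\<close> to \<open>B 2\<close> through \<open>A 0\<close>,
  \<open>A 1\<close> and \<open>A 2\<close> form a theta curve, and the arcs \<open>g i 0\<close>
  make all three points \<open>A i\<close> accessible from \<open>B 0\<close>.\<close>

lemma K33_not_in_plane:
  fixes A B :: "nat \<Rightarrow> complex" and g :: "nat \<Rightarrow> nat \<Rightarrow> real \<Rightarrow> complex"
  assumes g: "\<And>i j. i < 3 \<Longrightarrow> j < 3 \<Longrightarrow> arc (g i j) \<and> pathstart (g i j) = A i \<and> pathfinish (g i j) = B j"
    and same_A: "\<And>i j l. i < 3 \<Longrightarrow> j < 3 \<Longrightarrow> l < 3 \<Longrightarrow> j \<noteq> l \<Longrightarrow>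
      path_image (g i j) \<inter> path_image (g i l) \<subseteq> {A i}"
    and same_B: "\<And>i j k. i < 3 \<Longrightarrow> j < 3 \<Longrightarrow> k < 3 \<Longrightarrow> i \<noteq> k \<Longrightarrow>
      path_image (g i j) \<inter> path_image (g k j) \<subseteq> {B j}"
    and disj: "\<And>i j k l. i < 3 \<Longrightarrow> j < 3 \<Longrightarrow> k < 3 \<Longrightarrow> l < 3 \<Longrightarrow> i \<noteq> k \<Longrightarrow> j \<noteq> l \<Longrightarrow>
      path_image (g i j) \<inter> path_image (g k l) = {}"
  shows False
proof -
  define c where "c i = reversepath (g i 1) +++ g i 2" for i
  have im: "path_image (c i) = path_image (g i 1) \<union> path_image (g i 2)" if "i < 3" for i
    using g[of i] that by (simp add: c_def path_image_join)
  have ends: "A i \<in> path_image (g i j)" "B j \<in> path_image (g i j)" "A i \<noteq> B j" if "i < 3" "j < 3" for i j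
    using g[OF that] by (metis pathstart_in_path_image, metis pathfinish_in_path_image, metis arc_distinct_ends)
  have th: "theta_arcs (B 1) (B 2) c"
    unfolding theta_arcs_def
  proof (intro conjI allI impI)
    fix i :: nat assume i: "i < 3"
    show "arc (c i)" unfolding c_def
      using g[OF i] same_A[OF i, of 1 2] by (intro arc_join) (auto simp: arc_reversepath)
    show "pathstart (c i) = B 1" "pathfinish (c i) = B 2"
      using g[OF i] by (auto simp: c_def)
  next
    fix i j :: nat assume ij: "i < 3" "j < 3" "i \<noteq> j"
    have "path_image (c i) \<inter> path_image (c j) \<subseteq> {B 1, B 2}"
      using same_B[of i 1 j] same_B[of i 2 j] disj[of i 1 j 2] disj[of i 2 j 1] ij
      unfolding im[OF ij(1)] im[OF ij(2)] by simp blast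
    then show "path_image (c i) \<inter> path_image (c j) = {B 1, B 2}"
      using ends(2) ij unfolding im[OF ij(1)] im[OF ij(2)] by force
  qed
  have sub: "path_image (g i 0) \<inter> path_image (c j) \<subseteq> {A i}" if "i < 3" "j < 3" for i j
    using that same_A[of i 0 1] same_A[of i 0 2] disj[of i 0 j 1] disj[of i 0 j 2] im[of j]
    by (cases "i = j") force+
  show False
  proof (rule theta_no_common_access[OF th, of A "\<lambda>i. path_image (g i 0)" "B 0"])
    fix i :: nat assume i: "i < 3"
    show "connected (path_image (g i 0))"
      using g[OF i, of 0] by (simp add: arc_imp_path connected_path_image)
  qed (use ends im sub in auto)
qed

section \<open>Walks and subdivisions of \<open>K\<^sub>3\<^sub>,\<^sub>3\<close> in a graph\<close>

inductive walk_in :: "'v set set \<Rightarrow> 'v set \<Rightarrow> 'v \<Rightarrow> 'v \<Rightarrow> bool" for E W where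
  refl: "walk_in E W u u"
| step: "walk_in E W u v \<Longrightarrow> {v, w} \<in> E \<Longrightarrow> v \<in> W \<Longrightarrow> w \<in> W \<Longrightarrow> walk_in E W u w"

text \<open>The sets \<open>I i j\<close> contain the interior vertices of the branches of a subdivided \<open>K\<^sub>3\<^sub>,\<^sub>3\<close>;
  a walk suffices, since path-connected subsets of the plane are arcwise connected.\<close>

lemma planar_graph_no_K33_subdivision:
  fixes V :: "'v set" and E :: "'v set set" and a b :: "nat \<Rightarrow> 'v" and I :: "nat \<Rightarrow> nat \<Rightarrow> 'v set"
  assumes pl: "planar_graph V E"
    and a: "inj_on a {..<3}" "a ` {..<3} \<subseteq> V"
    and b: "inj_on b {..<3}" "b ` {..<3} \<subseteq> V"
    and ab: "a ` {..<3} \<inter> b ` {..<3} = {}"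
    and I: "\<And>i j. i < 3 \<Longrightarrow> j < 3 \<Longrightarrow> I i j \<subseteq> V - a ` {..<3} - b ` {..<3}"
    and disj_I: "\<And>i j k l. i < 3 \<Longrightarrow> j < 3 \<Longrightarrow> k < 3 \<Longrightarrow> l < 3 \<Longrightarrow> i \<noteq> k \<or> j \<noteq> l \<Longrightarrow> I i j \<inter> I k l = {}"
    and walk: "\<And>i j. i < 3 \<Longrightarrow> j < 3 \<Longrightarrow> walk_in E ({a i, b j} \<union> I i j) (a i) (b j)"
  shows False
proof -
  define W where "W i j = {a i, b j} \<union> I i j" for i j
  have mem: "a i \<in> a ` {..<3}" "b i \<in> b ` {..<3}" if "i < 3" for i
    using that by auto
  have inj: "a i \<noteq> a j" "b i \<noteq> b j" if "i < 3" "j < 3" "i \<noteq> j" for i j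
    using inj_onD[OF a(1), of i j] inj_onD[OF b(1), of i j] that by auto
  have ne: "a i \<noteq> b j" if "i < 3" "j < 3" for i j
    using ab mem(1)[OF that(1)] mem(2)[OF that(2)] by (metis IntI empty_iff)
  have WV: "W i j \<subseteq> V" if "i < 3" "j < 3" for i j
    using I[OF that] a(2) b(2) mem(1)[OF that(1)] mem(2)[OF that(2)] unfolding W_def by blast
  have aI: "a k \<notin> I i j" "b k \<notin> I i j" if "i < 3" "j < 3" "k < 3" for i j k
    using I[OF that(1,2)] mem[OF that(3)] by blast+
  have same_a: "W i j \<inter> W i l \<subseteq> {a i}" if "i < 3" "j < 3" "l < 3" "j \<noteq> l" for i j l
    using that disj_I[of i j i l] inj(2)[of j l] aI[of i j] aI[of i l] unfolding W_def by auto
  have same_b: "W i j \<inter> W k j \<subseteq> {b j}" if "i < 3" "j < 3" "k < 3" "i \<noteq> k" for i j k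
    using that disj_I[of i j k j] inj(1)[of i k] aI[of i j] aI[of k j] unfolding W_def by auto
  have disj: "W i j \<inter> W k l = {}" if "i < 3" "j < 3" "k < 3" "l < 3" "i \<noteq> k" "j \<noteq> l" for i j k l
    using that disj_I[of i j k l] inj(1)[of i k] inj(2)[of j l] ne[of i l] ne[of k j]
      aI[of i j] aI[of k l] unfolding W_def by auto
  obtain f :: "'v \<Rightarrow> complex" and \<gamma> where f: "inj_on f V"
    and \<gamma>: "\<And>e. e \<in> E \<Longrightarrow> arc (\<gamma> e) \<and> {pathstart (\<gamma> e), pathfinish (\<gamma> e)} = f ` e
                 \<and> path_image (\<gamma> e) \<inter> f ` V = f ` e"
    and \<gamma>2: "\<And>e e'. e \<in> E \<Longrightarrow> e' \<in> E \<Longrightarrow> e \<noteq> e' \<Longrightarrow> path_image (\<gamma> e) \<inter> path_image (\<gamma> e') \<subseteq> f ` (e \<inter> e')"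
    using pl unfolding planar_graph_def by metis
  \<comment> \<open>\<open>R Y\<close> is the drawing of the edges inside \<open>Y\<close>; a vertex
    of \<open>Y\<close> on no such edge contributes no point.\<close>
  define R where "R Y = \<Union> {path_image (\<gamma> e) | e. e \<in> E \<and> e \<subseteq> Y}" for Y
  have loop: "{u} \<notin> E" for u
    using \<gamma>[of "{u}"] arc_distinct_ends[of "\<gamma> {u}"] by auto
  \<comment> \<open>An edge inside both \<open>Y\<close> and \<open>Z\<close> would be empty or a
    loop at \<open>u\<close>, which an arc with two ends excludes. So the edges differ and meet only
    in drawn common vertices.\<close>
  have R_Int: "R Y \<inter> R Z \<subseteq> f ` (Y \<inter> Z)" if "Y \<inter> Z \<subseteq> {u}" for Y Z u
  proof
    fix x assume "x \<in> R Y \<inter> R Z"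
    then obtain e e' where e: "e \<in> E" "e \<subseteq> Y" "x \<in> path_image (\<gamma> e)"
      and e': "e' \<in> E" "e' \<subseteq> Z" "x \<in> path_image (\<gamma> e')"
      unfolding R_def by blast
    have "e \<noteq> {}" using \<gamma>[OF e(1)] by auto
    then have "e \<noteq> {u}" "e = {u}" if "e = e'"
      using e(1) loop[of u] subset_singletonD[of e u] e(2) e'(2) that \<open>Y \<inter> Z \<subseteq> {u}\<close> by blast+
    then have "e \<noteq> e'" by blast
    then show "x \<in> f ` (Y \<inter> Z)" using \<gamma>2[OF e(1) e'(1)] e e' by blast
  qed
  \<comment> \<open>The trivial walk is excluded because \<open>f u\<close> need not belong to
    \<open>R Y\<close>.\<close>
  have pc: "path_component (R Y) (f u) (f v)"
    if "walk_in E Y u v" "u \<noteq> v" for Y u v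
    using that
  proof (induction rule: walk_in.induct)
    case (refl u)
    then show ?case by simp
  next
    case (step u y z)
    then have yz: "{y, z} \<in> E" "{y, z} \<subseteq> Y" by auto
    have img: "path_image (\<gamma> {y, z}) \<subseteq> R Y" unfolding R_def using yz by blast
    have "{f y, f z} = {pathstart (\<gamma> {y, z}), pathfinish (\<gamma> {y, z})}" using \<gamma>[OF yz(1)] by auto
    moreover have "path_component (R Y) (pathstart (\<gamma> {y, z})) (pathfinish (\<gamma> {y, z}))"
      unfolding path_component_def using img \<gamma>[OF yz(1)] arc_imp_path by blast
    ultimately have *: "path_component (R Y) (f y) (f z)"
      by (metis doubleton_eq_iff path_component_sym)
    show ?case
      using step.IH * path_component_trans by (cases "u = y") blast+
  qed
  have "\<exists>g. arc g \<and> pathstart g = f (a i) \<and> pathfinish g = f (b j) \<and> path_image g \<subseteq> R (W i j)"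
    if ij: "i < 3" "j < 3" for i j
  proof -
    have "f (a i) \<noteq> f (b j)"
      using inj_onD[OF f, of "a i" "b j"] WV[OF ij] ne[OF ij] unfolding W_def by blast
    moreover obtain h where "path h" "path_image h \<subseteq> R (W i j)" "pathstart h = f (a i)" "pathfinish h = f (b j)"
      using pc[OF walk[OF ij] ne[OF ij]] unfolding path_component_def W_def by blast
    ultimately show ?thesis
      using path_contains_arc[of h "f (a i)" "f (b j)"] subset_trans by metis
  qed
  then obtain g where g: "\<And>i j. i < 3 \<Longrightarrow> j < 3 \<Longrightarrow> arc (g i j) \<and> pathstart (g i j) = f (a i) \<and>
      pathfinish (g i j) = f (b j) \<and> path_image (g i j) \<subseteq> R (W i j)"
    by metis
  show False
  proof (rule K33_not_in_plane[of g "\<lambda>i. f (a i)" "\<lambda>j. f (b j)"])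
    fix i j l :: nat assume *: "i < 3" "j < 3" "l < 3" "j \<noteq> l"
    show "path_image (g i j) \<inter> path_image (g i l) \<subseteq> {f (a i)}"
      using g[OF *(1,2)] g[OF *(1,3)] R_Int[OF same_a[OF *]] same_a[OF *] by blast
  next
    fix i j k :: nat assume *: "i < 3" "j < 3" "k < 3" "i \<noteq> k"
    show "path_image (g i j) \<inter> path_image (g k j) \<subseteq> {f (b j)}"
      using g[OF *(1,2)] g[OF *(3,2)] R_Int[OF same_b[OF *]] same_b[OF *] by blast
  next
    fix i j k l :: nat assume *: "i < 3" "j < 3" "k < 3" "l < 3" "i \<noteq> k" "j \<noteq> l"
    show "path_image (g i j) \<inter> path_image (g k l) = {}"
      using g[OF *(1,2)] g[OF *(3,4)] R_Int[of "W i j" "W k l"] disj[OF *] by blast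
  qed (use g in auto)
qed

lemma walk_in_mono: "walk_in E S u v \<Longrightarrow> S \<subseteq> T \<Longrightarrow> walk_in E T u v"
  by (induction rule: walk_in.induct) (auto intro: walk_in.intros)

lemma walk_in_trans: "walk_in E S v w \<Longrightarrow> walk_in E S u v \<Longrightarrow> walk_in E S u w"
  by (induction rule: walk_in.induct) (auto intro: walk_in.intros)

lemma walk_in_edge: "{u, v} \<in> E \<Longrightarrow> u \<in> S \<Longrightarrow> v \<in> S \<Longrightarrow> walk_in E S u v"
  by (meson walk_in.intros)

lemma walk_in_sym: "walk_in E S u v \<Longrightarrow> walk_in E S v u"
proof (induction rule: walk_in.induct)
  case (step u v w)
  then show ?case
    using walk_in_trans walk_in_edge by (metis insert_commute)
qed (rule walk_in.refl)

lemma less_3_cases: "(i::nat) < 3 \<Longrightarrow> i = 0 \<or> i = Suc 0 \<or> i = 2"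
  by auto

lemma lessThan_3: "{..<3} = {0, Suc 0, 2}"
  by auto

section \<open>Two forbidden configurations\<close>

text \<open>The branch vertices are \<open>v000\<close>, \<open>v011\<close>, \<open>v101\<close>
  against \<open>v111\<close>, \<open>v001\<close>, \<open>v010\<close>. Seven pairs are cube edges,
  \<open>v101\<close> reaches \<open>v010\<close> via \<open>v100\<close> and \<open>v110\<close>,
  and the walk in \<open>S\<close> joins \<open>v000\<close> to \<open>v111\<close>.\<close>

lemma planar_graph_cube_antipodes:
  fixes E :: "'v set set"
  assumes pl: "planar_graph V E"
    and dist: "distinct [v000, v100, v010, v001, v110, v101, v011, v111]"
    and inV: "{v000, v100, v010, v001, v110, v101, v011, v111} \<subseteq> V"
    and E: "{v000, v010} \<in> E" "{v000, v001} \<in> E"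
      "{v100, v110} \<in> E" "{v100, v101} \<in> E" "{v010, v110} \<in> E" "{v010, v011} \<in> E"
      "{v001, v101} \<in> E" "{v001, v011} \<in> E" "{v101, v111} \<in> E" "{v011, v111} \<in> E"
    and S: "S \<subseteq> V" "S \<inter> {v100, v010, v001, v110, v101, v011} = {}"
    and walk: "walk_in E S v000 v111"
  shows False
proof -
  \<comment> \<open>The reversed list supplies every inequality with its sides exchanged.\<close>
  have dist': "distinct (rev [v000, v100, v010, v001, v110, v101, v011, v111])"
    using dist by (simp only: distinct_rev)
  note ne = dist[simplified] dist'[simplified]
  have notS: "v100 \<notin> S" "v010 \<notin> S" "v001 \<notin> S" "v110 \<notin> S" "v101 \<notin> S" "v011 \<notin> S"
    using S by blast+
  define a where "a i = [v000, v011, v101] ! i" for i :: nat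
  define b where "b i = [v111, v001, v010] ! i" for i :: nat
  define I where "I i j = (if i = 0 \<and> j = 0 then S - {v000, v111}
    else if i = 2 \<and> j = 2 then {v100, v110} else {})" for i j :: nat
  have ab: "a 0 = v000" "a (Suc 0) = v011" "a 2 = v101" "b 0 = v111" "b (Suc 0) = v001" "b 2 = v010"
    by (simp_all add: a_def b_def)
  have E': "{v, u} \<in> E" if "{u, v} \<in> E" for u v
    using that by (simp add: insert_commute)
  have sym: "{v011, v001} \<in> E" "{v011, v010} \<in> E" "{v101, v001} \<in> E" "{v101, v100} \<in> E" "{v110, v010} \<in> E"
    using E E' by blast+
  have I00: "walk_in E ({a 0, b 0} \<union> I 0 0) (a 0) (b 0)"
    unfolding ab using walk by (rule walk_in_mono) (auto simp: I_def)
  have I22: "walk_in E ({a 2, b 2} \<union> I 2 2) (a 2) (b 2)"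
    unfolding ab
  proof (rule walk_in.step[OF walk_in.step[OF walk_in_edge]])
    show "{v101, v100} \<in> E" "{v100, v110} \<in> E" "{v110, v010} \<in> E"
      using E(3) sym by blast+
  qed (auto simp: I_def)
  have walks: "walk_in E ({a i, b j} \<union> I i j) (a i) (b j)" if "i < 3" "j < 3" for i j
  proof (cases "i = 0 \<and> j = 0 \<or> i = 2 \<and> j = 2")
    case False
    then have "{a i, b j} \<in> E"
      using less_3_cases[OF that(1)] less_3_cases[OF that(2)] E sym by (elim disjE) (simp_all add: ab)
    then show ?thesis by (rule walk_in_edge) auto
  qed (use I00 I22 in auto)
  show False
  proof (rule planar_graph_no_K33_subdivision[OF pl, of a b I])
    show "I i j \<subseteq> V - a ` {..<3} - b ` {..<3}" for i j
      using inV S(1) ne notS by (auto simp: I_def lessThan_3 ab)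
    show "I i j \<inter> I k l = {}" if "i \<noteq> k \<or> j \<noteq> l" for i j k l
      using that notS by (auto simp: I_def)
  qed (use walks inV ne in \<open>simp_all add: lessThan_3 ab\<close>)
qed

text \<open>The centres \<open>s i 0\<close> and the vertices \<open>m j\<close> are the branch
  vertices. The centre is adjacent to \<open>m 0\<close>, and for \<open>j > 0\<close> the leaf
  \<open>s i j\<close> subdivides the branch to \<open>m j\<close>.\<close>

lemma planar_graph_three_stars:
  fixes E :: "'v set set" and s :: "nat \<Rightarrow> nat \<Rightarrow> 'v" and m :: "nat \<Rightarrow> 'v"
  assumes pl: "planar_graph V E"
    and inV: "\<And>i j. i < 3 \<Longrightarrow> j < 3 \<Longrightarrow> s i j \<in> V" "\<And>j. j < 3 \<Longrightarrow> m j \<in> V"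
    and inj_s: "\<And>i j k l. i < 3 \<Longrightarrow> j < 3 \<Longrightarrow> k < 3 \<Longrightarrow> l < 3 \<Longrightarrow> s i j = s k l \<Longrightarrow> i = k \<and> j = l"
    and inj_m: "\<And>j l. j < 3 \<Longrightarrow> l < 3 \<Longrightarrow> m j = m l \<Longrightarrow> j = l"
    and sm: "\<And>i j l. i < 3 \<Longrightarrow> j < 3 \<Longrightarrow> l < 3 \<Longrightarrow> s i j \<noteq> m l"
    and Es: "\<And>i j. i < 3 \<Longrightarrow> 0 < j \<Longrightarrow> j < 3 \<Longrightarrow> {s i 0, s i j} \<in> E"
    and Em: "\<And>i j. i < 3 \<Longrightarrow> j < 3 \<Longrightarrow> {s i j, m j} \<in> E"
  shows False
proof (rule planar_graph_no_K33_subdivision[OF pl, of "\<lambda>i. s i 0" m "\<lambda>i j. if j = 0 then {} else {s i j}"])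
  show "inj_on (\<lambda>i. s i 0) {..<3}" "inj_on m {..<3}"
    using inj_s[of _ 0 _ 0] inj_m by (auto intro!: inj_onI)
  show "(\<lambda>i. s i 0) ` {..<3} \<subseteq> V" "m ` {..<3} \<subseteq> V"
    using inV by auto
  show "(\<lambda>i. s i 0) ` {..<3} \<inter> m ` {..<3} = {}"
    using sm by fastforce
next
  fix i j :: nat assume ij: "i < 3" "j < 3"
  show "(if j = 0 then {} else {s i j}) \<subseteq> V - (\<lambda>i. s i 0) ` {..<3} - m ` {..<3}"
    using inV(1)[OF ij] sm[OF ij] inj_s[OF ij, of _ 0] by auto
  have "walk_in E ({s i 0, m j} \<union> (if j = 0 then {} else {s i j})) (s i 0) (s i j)"
    using Es[of i j] ij by (cases "j = 0") (auto intro: walk_in.refl walk_in_edge)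
  then show "walk_in E ({s i 0, m j} \<union> (if j = 0 then {} else {s i j})) (s i 0) (m j)"
    using Em[OF ij] by (rule walk_in.step) auto
next
  fix i j k l :: nat assume "i < 3" "j < 3" "k < 3" "l < 3" "i \<noteq> k \<or> j \<noteq> l"
  then show "(if j = 0 then {} else {s i j}) \<inter> (if l = 0 then {} else {s k l}) = {}"
    using inj_s[of i j k l] by auto
qed

subsection \<open>Cyclic subgroups\<close>

context group
begin

section \<open>Powers of an element and edges between cyclic subgroups\<close>

lemma mem_generate_singleton:
  assumes "x \<in> carrier G"
  shows "y \<in> generate G {x} \<longleftrightarrow> (\<exists>k::int. y = x [^] k)"
  using generate_pow[OF assms] by auto

lemma generate_singleton_subset_iff:
  assumes "subgroup H G"
  shows "generate G {x} \<subseteq> H \<longleftrightarrow> x \<in> H"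
  using generate_subgroup_incl[OF _ assms, of "{x}"] generate.incl[of x "{x}" G] by blast

lemma subgroup_generate_singleton:
  assumes "x \<in> carrier G"
  shows "subgroup (generate G {x}) G"
  using generate_is_subgroup[of "{x}"] assms by simp

lemma coprime_powers_mem:
  fixes m n :: int
  assumes H: "subgroup H G" and x: "x \<in> carrier G"
    and "x [^] m \<in> H" "x [^] n \<in> H" "coprime m n"
  shows "x \<in> H"
proof -
  obtain u v where "u * m + v * n = 1"
    using bezout_int[of m n] \<open>coprime m n\<close> by auto
  then have "x = x [^] (m * u + n * v)"
    using x by (simp add: mult.commute)
  also have "\<dots> = (x [^] m) [^] u \<otimes> (x [^] n) [^] v"
    using x by (simp add: int_pow_mult int_pow_pow)
  also have "\<dots> \<in> H"
    using assms by (simp add: subgroup_int_pow_closed subgroup.m_closed)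
  finally show ?thesis .
qed

lemma coprime_nat_powers_mem:
  fixes m n :: nat
  assumes "subgroup H G" "x \<in> carrier G" "x [^] m \<in> H" "x [^] n \<in> H" "coprime m n"
  shows "x \<in> H"
  using coprime_powers_mem[of H x "int m" "int n"] assms by (simp add: int_pow_int)

text \<open>A subgroup strictly above the smaller one contains some \<open>x [^] k\<close> with
  \<open>l\<close> not dividing \<open>k\<close>; as \<open>l\<close> is prime, Bezout then puts
  \<open>x\<close> itself into it.\<close>

lemma maximal_subgroup_prime_power:
  assumes x: "x \<in> carrier G" and l: "Factorial_Ring.prime (l::nat)"
    and notin: "x \<notin> generate G {x [^] l}"
  shows "maximal_subgroup_of G (generate G {x [^] l}) (generate G {x})"
proof -
  have sub: "subgroup (generate G {x}) G" "subgroup (generate G {x [^] l}) G"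
    using x by (simp_all add: subgroup_generate_singleton)
  have "x [^] l \<in> generate G {x}"
    using mem_generate_singleton[OF x] int_pow_int[of G x l] by metis
  then have incl: "generate G {x [^] l} \<subseteq> generate G {x}"
    using generate_singleton_subset_iff[OF sub(1)] by simp
  have "L = generate G {x [^] l} \<or> L = generate G {x}"
    if L: "subgroup L G" "generate G {x [^] l} \<subseteq> L" "L \<subseteq> generate G {x}" for L
  proof (cases "L \<subseteq> generate G {x [^] l}")
    case False
    then obtain z where z: "z \<in> L" "z \<notin> generate G {x [^] l}" by blast
    then obtain k :: int where "z = x [^] k"
      using L(3) mem_generate_singleton[OF x] by blast
    with z have k: "x [^] k \<in> L" "x [^] k \<notin> generate G {x [^] l}" by simp_all
    have "\<not> int l dvd k"
    proof
      assume "int l dvd k"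
      then obtain j where "k = int l * j" by blast
      then have "x [^] k = (x [^] l) [^] j"
        using int_pow_pow[OF x, of "int l" j] by (simp add: int_pow_int)
      then show False
        using k(2) mem_generate_singleton[of "x [^] l"] x by blast
    qed
    then have "coprime k (int l)"
      using l by (metis coprime_commute prime_imp_coprime prime_nat_int_transfer)
    moreover have "x [^] int l \<in> L"
      using L(2) generate_singleton_subset_iff[OF L(1)] by (simp add: int_pow_int)
    ultimately have "x \<in> L" using coprime_powers_mem[OF L(1) x k(1)] by blast
    then show ?thesis using L(3) generate_singleton_subset_iff[OF L(1)] by blast
  qed (use L in blast)
  moreover have "generate G {x [^] l} \<noteq> generate G {x}"
    using notin generate.incl[of x "{x}" G] by blast
  ultimately show ?thesis
    unfolding maximal_subgroup_of_def using sub incl by (simp add: psubset_eq)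
qed

text \<open>The exponent \<open>j\<close> agrees with a multiple of \<open>k\<close> modulo
  \<open>ord x\<close>, hence is zero modulo \<open>k\<close>. Infinite order is covered: there
  \<open>ord x = 0\<close>, which every \<open>k\<close> divides.\<close>

lemma power_mem_generate_power:
  assumes x: "x \<in> carrier G" and "k dvd ord x" and "x [^] (j::nat) \<in> generate G {x [^] (k::nat)}"
  shows "k dvd j"
proof -
  obtain i :: int where "x [^] j = (x [^] k) [^] i"
    using assms mem_generate_singleton by auto
  then have "x [^] int j = x [^] (int k * i)"
    using x by (simp add: int_pow_int int_pow_pow[symmetric])
  then have "int (ord x) dvd int k * i - int j" using x int_pow_eq by blast
  then have "int k dvd int k * i - int j" using \<open>k dvd ord x\<close> by (meson dvd_trans int_dvd_int_iff)
  then show ?thesis by (metis dvd_diff_right_iff dvd_triv_left int_dvd_int_iff)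
qed

text \<open>This turns distinctness of vertices in the subgroup graph into distinctness of
  divisors.\<close>

lemma generate_power_eq_iff:
  assumes x: "x \<in> carrier G" and "j dvd ord x" "k dvd ord x"
  shows "generate G {x [^] (j::nat)} = generate G {x [^] (k::nat)} \<longleftrightarrow> j = k"
proof
  assume eq: "generate G {x [^] j} = generate G {x [^] k}"
  have "x [^] j \<in> generate G {x [^] k}" "x [^] k \<in> generate G {x [^] j}"
    using generate.incl[of "x [^] j" "{x [^] j}" G] generate.incl[of "x [^] k" "{x [^] k}" G] eq
    by simp_all
  then show "j = k"
    using power_mem_generate_power[OF x assms(2)] power_mem_generate_power[OF x assms(3)]
    by (simp add: dvd_antisym)
qed simp

lemma subgroup_graph_edge:
  assumes x: "x \<in> carrier G" and fin: "ord x \<noteq> 0" and l: "Factorial_Ring.prime (l::nat)"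
    and dvd: "k * l dvd ord x"
  shows "{generate G {x [^] k}, generate G {x [^] (k * l)}} \<in> subgroup_graph_edges G"
proof -
  have "k \<noteq> 0" using fin dvd by auto
  have "\<not> k * l dvd k"
    using l \<open>k \<noteq> 0\<close> by (auto dest: prime_gt_1_nat dvd_imp_le)
  then have "x [^] k \<notin> generate G {(x [^] k) [^] l}"
    using power_mem_generate_power[OF x dvd, of k] x by (auto simp: nat_pow_pow)
  then have "maximal_subgroup_of G (generate G {(x [^] k) [^] l}) (generate G {x [^] k})"
    using maximal_subgroup_prime_power[OF _ l, of "x [^] k"] x by blast
  then show ?thesis
    unfolding subgroup_graph_edges_def using x by (auto simp: nat_pow_pow insert_commute)
qed

lemma subgroup_graph_edge_swap:
  "{U, V} \<in> subgroup_graph_edges G \<Longrightarrow> {V, U} \<in> subgroup_graph_edges G"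
  by (simp add: insert_commute)

lemma generate_power_in_vertices:
  "x \<in> carrier G \<Longrightarrow> generate G {x [^] (k::nat)} \<in> subgroup_graph_vertices G"
  by (simp add: subgroup_graph_vertices_def subgroup_generate_singleton)

section \<open>Chain conditions on subgroups\<close>

text \<open>In this form the chain condition supplies maximal members of nonempty sets of
  subgroups.\<close>

lemma subgroup_acc_wf:
  assumes "subgroup_acc G"
  shows "wf {(L, K). subgroup L G \<and> subgroup K G \<and> K \<subset> L}"
  unfolding wf_iff_no_infinite_down_chain
proof
  assume "\<exists>f. \<forall>i. (f (Suc i), f i) \<in> {(L, K). subgroup L G \<and> subgroup K G \<and> K \<subset> L}"
  then obtain f where "\<forall>i. (f (Suc i), f i) \<in> {(L, K). subgroup L G \<and> subgroup K G \<and> K \<subset> L}" ..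
  then have f: "subgroup (f i) G \<and> f i \<subset> f (Suc i)" for i by simp
  then have "\<forall>n. subgroup (f n) G" "\<forall>n. f n \<subseteq> f (Suc n)" by blast+
  then have "\<exists>N. \<forall>n\<ge>N. f n = f N"
    using assms unfolding subgroup_acc_def by simp
  then obtain N where N: "\<forall>n\<ge>N. f n = f N" ..
  have "f (Suc N) = f N" by (rule N[rule_format]) simp
  then show False using f[of N] by simp
qed

lemma subgroup_dcc_wf:
  assumes "subgroup_dcc G"
  shows "wf {(K, L). subgroup K G \<and> subgroup L G \<and> K \<subset> L}"
  unfolding wf_iff_no_infinite_down_chain
proof
  assume "\<exists>f. \<forall>i. (f (Suc i), f i) \<in> {(K, L). subgroup K G \<and> subgroup L G \<and> K \<subset> L}"
  then obtain f where "\<forall>i. (f (Suc i), f i) \<in> {(K, L). subgroup K G \<and> subgroup L G \<and> K \<subset> L}" ..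
  then have f: "subgroup (f i) G \<and> f (Suc i) \<subset> f i" for i by simp
  then have "\<forall>n. subgroup (f n) G" "\<forall>n. f (Suc n) \<subseteq> f n" by blast+
  then have "\<exists>N. \<forall>n\<ge>N. f n = f N"
    using assms unfolding subgroup_dcc_def by simp
  then obtain N where N: "\<forall>n\<ge>N. f n = f N" ..
  have "f (Suc N) = f N" by (rule N[rule_format]) simp
  then show False using f[of N] by simp
qed

text \<open>For \<open>x\<close> of infinite order the subgroups generated by
  \<open>x [^] (2 ^ n)\<close> would descend strictly forever.\<close>

lemma subgroup_dcc_ord_nonzero:
  assumes "subgroup_dcc G" and x: "x \<in> carrier G"
  shows "ord x \<noteq> 0"
proof
  assume 0: "ord x = 0"
  define F where "F n = generate G {x [^] ((2::nat) ^ n)}" for n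
  have sub: "subgroup (F n) G" for n
    using x by (simp add: F_def subgroup_generate_singleton)
  have "F (Suc n) \<subseteq> F n" for n
  proof -
    have "x [^] ((2::nat) ^ Suc n) = (x [^] ((2::nat) ^ n)) [^] (2::int)"
      using x int_pow_int[of G _ 2] by (simp add: nat_pow_pow mult.commute)
    then have "x [^] ((2::nat) ^ Suc n) \<in> F n"
      unfolding F_def using x mem_generate_singleton[of "x [^] ((2::nat) ^ n)"] by blast
    then show ?thesis using sub[of n] generate_singleton_subset_iff unfolding F_def by blast
  qed
  then obtain N where "F (Suc N) = F N"
    using assms(1) sub unfolding subgroup_dcc_def by (metis le_Suc_eq order_refl)
  then have "x [^] ((2::nat) ^ N) \<in> generate G {x [^] ((2::nat) ^ Suc N)}"
    using generate.incl[of "x [^] ((2::nat) ^ N)" "{x [^] ((2::nat) ^ N)}" G] unfolding F_def by auto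
  then have "(2::nat) ^ Suc N dvd 2 ^ N"
    using power_mem_generate_power[OF x] 0 by auto
  then show False by (simp add: power_dvd_imp_le)
qed

text \<open>The ascending condition yields a maximal subgroup \<open>M\<close> of \<open>L\<close>
  above \<open>K\<close>; the descending one lets the induction continue from \<open>M\<close>.
  Staying above \<open>K\<close> is what later keeps walks away from a given set of
  subgroups.\<close>

lemma walk_to_larger_subgroup:
  assumes acc: "subgroup_acc G" and dcc: "subgroup_dcc G"
    and "subgroup K G" "subgroup L G" "K \<subseteq> L"
  shows "walk_in (subgroup_graph_edges G) {U. subgroup U G \<and> K \<subseteq> U} K L"
  using \<open>subgroup L G\<close> \<open>K \<subseteq> L\<close>
proof (induction L rule: wf_induct_rule[OF subgroup_dcc_wf[OF dcc]])
  case (1 L)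
  show ?case
  proof (cases "K = L")
    case False
    define S where "S = {U. subgroup U G \<and> K \<subseteq> U \<and> U \<subset> L}"
    have "K \<in> S" using False \<open>K \<subseteq> L\<close> \<open>subgroup K G\<close> by (auto simp: S_def)
    then obtain M where "M \<in> S"
      and max: "\<forall>U. (U, M) \<in> {(L, K). subgroup L G \<and> subgroup K G \<and> K \<subset> L} \<longrightarrow> U \<notin> S"
      using subgroup_acc_wf[OF acc, unfolded wf_eq_minimal] by (elim allE[of _ S]) blast
    then have M: "subgroup M G" "K \<subseteq> M" "M \<subset> L" by (simp_all add: S_def)
    have "U = M \<or> U = L" if "subgroup U G" "M \<subseteq> U" "U \<subseteq> L" for U
    proof (rule ccontr)
      assume ne: "\<not> (U = M \<or> U = L)"
      then have "U \<in> S" using that M by (auto simp: S_def)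
      moreover have "M \<subset> U" using ne that by auto
      ultimately show False using max that M by simp
    qed
    then have "maximal_subgroup_of G M L"
      using M \<open>subgroup L G\<close> unfolding maximal_subgroup_of_def by simp
    then have "{M, L} \<in> subgroup_graph_edges G"
      unfolding subgroup_graph_edges_def by blast
    moreover have "walk_in (subgroup_graph_edges G) {U. subgroup U G \<and> K \<subseteq> U} K M"
      using "1.IH"[of M] M \<open>subgroup L G\<close> by simp
    ultimately show ?thesis
      using M \<open>subgroup L G\<close> \<open>K \<subseteq> L\<close> by (intro walk_in.step[of _ _ K M L]) simp_all
  qed (simp add: walk_in.refl)
qed

section \<open>Elements of prime order\<close>

lemma prime_order_mem_generate:
  assumes pl: "planar_group G" and acc: "subgroup_acc G" and dcc: "subgroup_dcc G"
    and x: "x \<in> carrier G" and ord: "ord x = p * q * r"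
    and pr: "Factorial_Ring.prime (p::nat)" "Factorial_Ring.prime q" "Factorial_Ring.prime r"
    and ne: "p \<noteq> q" "q \<noteq> r" "p \<noteq> r"
    and y: "y \<in> carrier G" and l: "Factorial_Ring.prime (ord y)"
  shows "y \<in> generate G {x}"
proof (rule ccontr)
  assume nin: "y \<notin> generate G {x}"
  let ?E = "subgroup_graph_edges G"
  define C where "C k = generate G {x [^] (k::nat)}" for k
  have C1: "C 1 = generate G {x}" using x by (simp add: C_def)
  have sub: "subgroup (C k) G" for k unfolding C_def using x by (simp add: subgroup_generate_singleton)
  have C0: "C (p * q * r) = {\<one>}"
    using pow_ord_eq_1[OF x] by (simp add: C_def ord generate_one)
  have pos: "p > 1" "q > 1" "r > 1" using pr prime_gt_1_nat by auto
  have dvds: "1 dvd ord x" "p dvd ord x" "q dvd ord x" "r dvd ord x" "p * q dvd ord x"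
      "p * r dvd ord x" "q * r dvd ord x" "p * q * r dvd ord x"
    unfolding ord by (simp_all add: mult.assoc mult.left_commute)
  have neq: "C j \<noteq> C k" if "j dvd ord x" "k dvd ord x" "j \<noteq> k" for j k
    using generate_power_eq_iff[OF x that(1,2)] that(3) by (simp add: C_def)
  have C_le: "C k \<subseteq> C 1" for k
    using mem_generate_singleton[OF x, of "x [^] k"] int_pow_int[of G x k]
      generate_singleton_subset_iff[OF sub, of "x [^] k" 1]
    unfolding C1 by (simp add: C_def) metis
  \<comment> \<open>Apart from the two antipodes, \<open>S\<close> has only subgroups not contained
    in \<open>C 1\<close>, so it avoids the other six vertices of the cube. Everything above
    \<open>?Y\<close> or above \<open>C 1\<close> is in \<open>S\<close>.\<close>
  define S where "S = {U. subgroup U G \<and> \<not> U \<subseteq> C 1} \<union> {C 1, {\<one>}}"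
  let ?Y = "generate G {y}"
  have subY: "subgroup ?Y G" using y by (simp add: subgroup_generate_singleton)
  have Y: "y \<in> ?Y" by (simp add: generate.incl)
  have "generate G {y [^] ord y} = {\<one>}" using y generate_one by simp
  then have e1: "{?Y, {\<one>}} \<in> ?E"
    using subgroup_graph_edge[OF y _ l, of 1] l y by (auto simp: prime_gt_0_nat)
  have top: "subgroup (carrier G) G" by (rule subgroup_self)
  have above_y: "{U. subgroup U G \<and> ?Y \<subseteq> U} \<subseteq> S"
    using Y nin by (auto simp: S_def C1[symmetric])
  have "{\<one>} \<in> S" "?Y \<in> S" using above_y subY by (auto simp: S_def)
  then have w1: "walk_in ?E S {\<one>} ?Y"
    using subgroup_graph_edge_swap[OF e1] by (intro walk_in_edge)
  have w2: "walk_in ?E S ?Y (carrier G)"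
    using walk_to_larger_subgroup[OF acc dcc subY top subgroup.subset[OF subY]] above_y
    by (rule walk_in_mono)
  have "{U. subgroup U G \<and> C 1 \<subseteq> U} \<subseteq> S" by (auto simp: S_def)
  with walk_to_larger_subgroup[OF acc dcc sub top subgroup.subset[OF sub]]
  have w3: "walk_in ?E S (C 1) (carrier G)" by (rule walk_in_mono)
  \<comment> \<open>The route is trivial subgroup, \<open>?Y\<close>, \<open>carrier G\<close>,
    \<open>C 1\<close>.\<close>
  have walk: "walk_in ?E S (C (p * q * r)) (C 1)"
    unfolding C0 by (rule walk_in_trans[OF walk_in_sym[OF w3] walk_in_trans[OF w2 w1]])
  have edge: "{C k, C (k * l)} \<in> ?E" "{C (k * l), C k} \<in> ?E"
    if "Factorial_Ring.prime l" "k * l dvd ord x" for k l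
    using subgroup_graph_edge[OF x _ that] pos ord unfolding C_def
    by (auto simp: insert_commute)
  have pq: "p * q \<noteq> p * r" "p * q \<noteq> q * r" "p * r \<noteq> q * r" "p * q * r \<noteq> p" "p * q * r \<noteq> q" "p * q * r \<noteq> r"
    "p * q \<noteq> p" "p * q \<noteq> q" "p * r \<noteq> p" "p * r \<noteq> r" "q * r \<noteq> q" "q * r \<noteq> r"
    "p * q * r \<noteq> p * q" "p * q * r \<noteq> p * r" "p * q * r \<noteq> q * r"
    "p * q * r \<noteq> 1" "p * q \<noteq> 1" "p * r \<noteq> 1" "q * r \<noteq> 1"
    using pos ne by auto
  have pq': "p * q \<noteq> r" "p * r \<noteq> q" "q * r \<noteq> p"
    using pr ne by (metis dvd_triv_left primes_dvd_imp_eq)+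
  \<comment> \<open>The order matches the cube labels: the three bits record whether
    \<open>p\<close>, \<open>q\<close>, \<open>r\<close> divide the order of the subgroup, and
    \<open>C k\<close> has order \<open>p * q * r\<close> divided by \<open>k\<close>.\<close>
  let ?D = "[p * q * r, q * r, p * r, p * q, r, q, p, 1]"
  have "distinct ?D" using pq pq' ne pos by auto
  moreover have "inj_on C (set ?D)"
    by (rule inj_onI, rule ccontr) (use neq dvds in auto)
  ultimately have dist: "distinct [C (p*q*r), C (q*r), C (p*r), C (p*q), C r, C q, C p, C 1]"
    using distinct_map[of C ?D] by simp
  show False
  proof (rule planar_graph_cube_antipodes[OF _ dist, of "subgroup_graph_vertices G" ?E S])
    show "planar_graph (subgroup_graph_vertices G) ?E"
      using pl unfolding planar_group_def .
    show "{C (p*q*r), C (q*r), C (p*r), C (p*q), C r, C q, C p, C 1} \<subseteq> subgroup_graph_vertices G"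
      using sub by (simp add: subgroup_graph_vertices_def)
    show "S \<subseteq> subgroup_graph_vertices G"
      using sub triv_subgroup by (auto simp: subgroup_graph_vertices_def S_def)
    have "distinct (rev [C (p*q*r), C (q*r), C (p*r), C (p*q), C r, C q, C p, C 1])"
      using dist by (simp only: distinct_rev)
    with dist have "\<forall>U \<in> {C (q*r), C (p*r), C (p*q), C r, C q, C p}. U \<noteq> C 1 \<and> U \<noteq> C (p*q*r)"
      by (simp del: mult_cancel1 mult_cancel2)
    moreover have "\<forall>U \<in> {C (q*r), C (p*r), C (p*q), C r, C q, C p}. U \<subseteq> C 1"
      using C_le by blast
    ultimately show "S \<inter> {C (q*r), C (p*r), C (p*q), C r, C q, C p} = {}"
      unfolding S_def C0[symmetric] by blast
    show "{C (p*q*r), C (p*r)} \<in> ?E" using edge(2)[of q "p*r"] pr dvds by (simp add: ac_simps)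
    show "{C (p*q*r), C (p*q)} \<in> ?E" using edge(2)[of r "p*q"] pr dvds by (simp add: ac_simps)
    show "{C (q*r), C r} \<in> ?E" using edge(2)[of q r] pr dvds by (simp add: ac_simps)
    show "{C (q*r), C q} \<in> ?E" using edge(2)[of r q] pr dvds by (simp add: ac_simps)
    show "{C (p*r), C r} \<in> ?E" using edge(2)[of p r] pr dvds by (simp add: ac_simps)
    show "{C (p*r), C p} \<in> ?E" using edge(2)[of r p] pr dvds by (simp add: ac_simps)
    show "{C (p*q), C q} \<in> ?E" using edge(2)[of p q] pr dvds by (simp add: ac_simps)
    show "{C (p*q), C p} \<in> ?E" using edge(2)[of q p] pr dvds by (simp add: ac_simps)
    show "{C q, C 1} \<in> ?E" using edge(2)[of q 1] pr dvds by simp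
    show "{C p, C 1} \<in> ?E" using edge(2)[of p 1] pr dvds by simp
  qed (rule walk)
qed

section \<open>Conjugation and normal cyclic subgroups\<close>

lemma conjugation_hom:
  assumes g: "g \<in> carrier G"
  shows "(\<lambda>x. g \<otimes> x \<otimes> inv g) \<in> hom G G"
proof (rule homI)
  fix x y assume xy: "x \<in> carrier G" "y \<in> carrier G"
  have "g \<otimes> x \<otimes> inv g \<otimes> (g \<otimes> y \<otimes> inv g) = g \<otimes> x \<otimes> (inv g \<otimes> g) \<otimes> y \<otimes> inv g"
    using g xy by (simp only: m_assoc m_closed inv_closed)
  then show "g \<otimes> (x \<otimes> y) \<otimes> inv g = g \<otimes> x \<otimes> inv g \<otimes> (g \<otimes> y \<otimes> inv g)"
    using g xy by (simp add: m_assoc)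
qed (use g in simp)

lemma conjugate_nat_pow:
  assumes "g \<in> carrier G" "x \<in> carrier G"
  shows "(g \<otimes> x \<otimes> inv g) [^] (n::nat) = g \<otimes> x [^] n \<otimes> inv g"
  using hom_nat_pow[OF conjugation_hom[OF assms(1)] assms(2) is_group is_group] by simp

lemma conjugate_int_pow:
  assumes "g \<in> carrier G" "x \<in> carrier G"
  shows "(g \<otimes> x \<otimes> inv g) [^] (n::int) = g \<otimes> x [^] n \<otimes> inv g"
  using hom_int_pow[OF conjugation_hom[OF assms(1)] assms(2) is_group is_group] by simp

lemma conjugate_eq_iff:
  assumes "g \<in> carrier G" "x \<in> carrier G" "y \<in> carrier G"
  shows "g \<otimes> x \<otimes> inv g = y \<longleftrightarrow> g \<otimes> x = y \<otimes> g"
  using inv_solve_right[of y "g \<otimes> x" g] assms by auto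

lemma conjugate_eq_one_iff:
  assumes "g \<in> carrier G" "x \<in> carrier G"
  shows "g \<otimes> x \<otimes> inv g = \<one> \<longleftrightarrow> x = \<one>"
  using conjugate_eq_iff[of g x \<one>] assms by simp

lemma ord_conjugate:
  assumes "g \<in> carrier G" "x \<in> carrier G"
  shows "ord (g \<otimes> x \<otimes> inv g) = ord x"
proof -
  have "(g \<otimes> x \<otimes> inv g) [^] n = \<one> \<longleftrightarrow> ord x dvd n" for n :: nat
    using assms by (simp add: conjugate_nat_pow conjugate_eq_one_iff pow_eq_id)
  then show ?thesis using assms by (simp add: ord_unique)
qed

text \<open>The powers of \<open>x\<close> with exponents \<open>q * r\<close>,
  \<open>p * r\<close>, \<open>p * q\<close> have prime order, and these exponents have no common
  divisor; Bezout gives first \<open>x [^] r\<close>, then \<open>x\<close>. Applied to conjugates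
  of an element, this shows that it generates a normal subgroup.\<close>

lemma mem_subgroup_if_prime_order_mem:
  assumes H: "subgroup H G"
    and prime_mem: "\<And>y. y \<in> carrier G \<Longrightarrow> Factorial_Ring.prime (ord y) \<Longrightarrow> y \<in> H"
    and x: "x \<in> carrier G" and ord: "ord x = p * q * r"
    and pr: "Factorial_Ring.prime (p::nat)" "Factorial_Ring.prime q" "Factorial_Ring.prime r"
    and ne: "p \<noteq> q" "q \<noteq> r" "p \<noteq> r"
  shows "x \<in> H"
proof -
  have pos: "p > 0" "q > 0" "r > 0" using pr by (simp_all add: prime_gt_0_nat)
  have cop: "coprime p q" "coprime q r" "coprime p r"
    using pr ne primes_coprime by blast+
  have "ord (x [^] (q * r)) = p" "ord (x [^] (p * r)) = q" "ord (x [^] (p * q)) = r"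
    using ord_pow[OF x, of "q * r"] ord_pow[OF x, of "p * r"] ord_pow[OF x, of "p * q"] pos
    by (simp_all add: ord mult.assoc mult.left_commute)
  then have mem: "x [^] (q * r) \<in> H" "x [^] (p * r) \<in> H" "x [^] (p * q) \<in> H"
    using prime_mem x pr by simp_all
  have "x [^] r \<in> H"
    using mem x cop(1)
    by (intro coprime_nat_powers_mem[OF H, of "x [^] r" p q]) (simp_all add: nat_pow_pow mult.commute)
  then show "x \<in> H"
    using coprime_nat_powers_mem[OF H x, of r "p * q"] mem(3) cop by (simp add: coprime_commute)
qed

lemma finite_generate_singleton:
  assumes "x \<in> carrier G" "ord x \<noteq> 0"
  shows "finite (generate G {x})"
  using generate_pow_card[OF assms(1)] assms(2) by (intro card_ge_0_finite) simp

text \<open>Conjugating \<open>d\<close> sends \<open>carrier G\<close> to a finite set, and the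
  nonempty fibres are cosets of the centralizer. Were the centralizer inside the finite subgroup
  generated by \<open>d\<close>, the whole group would be finite.\<close>

lemma centralizer_not_subset_normal_cyclic:
  assumes inf: "infinite (carrier G)" and d: "d \<in> carrier G" and fin: "ord d \<noteq> 0"
    and norm: "\<And>g. g \<in> carrier G \<Longrightarrow> g \<otimes> d \<otimes> inv g \<in> generate G {d}"
  shows "\<exists>y \<in> carrier G. y \<otimes> d = d \<otimes> y \<and> y \<notin> generate G {d}"
proof (rule ccontr)
  assume no: "\<not> ?thesis"
  have cent: "y \<in> generate G {d}" if "y \<in> carrier G" "y \<otimes> d = d \<otimes> y" for y
    using no that by blast
  let ?F = "\<lambda>v. {g \<in> carrier G. g \<otimes> d \<otimes> inv g = v}"
  have "finite (?F v)" for v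
  proof (cases "?F v = {}")
    case False
    then obtain h where h: "h \<in> carrier G" "h \<otimes> d \<otimes> inv h = v" by blast
    have "g \<in> (\<lambda>z. h \<otimes> z) ` generate G {d}" if g: "g \<in> carrier G" "g \<otimes> d \<otimes> inv g = v" for g
    proof -
      have v: "v \<in> carrier G" using h d by auto
      have "inv h \<otimes> g \<otimes> d = inv h \<otimes> (v \<otimes> g)"
        using g h v d conjugate_eq_iff[of g d v] by (simp add: m_assoc)
      also have "\<dots> = inv h \<otimes> (h \<otimes> d \<otimes> inv h) \<otimes> g"
        using g h v by (simp add: m_assoc)
      also have "\<dots> = d \<otimes> (inv h \<otimes> g)"
        using g(1) h(1) d by (simp flip: m_assoc)
      finally have "inv h \<otimes> g \<otimes> d = d \<otimes> (inv h \<otimes> g)" .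
      then have "inv h \<otimes> g \<in> generate G {d}" using cent g h by simp
      moreover have "g = h \<otimes> (inv h \<otimes> g)" using g h by (simp add: m_assoc[symmetric])
      ultimately show ?thesis by blast
    qed
    then have "?F v \<subseteq> (\<lambda>z. h \<otimes> z) ` generate G {d}" by blast
    then show ?thesis
      using finite_generate_singleton[OF d fin] finite_subset by blast
  next
    case True
    then show ?thesis by (simp only: finite.emptyI)
  qed
  moreover have "carrier G \<subseteq> (\<Union>v \<in> generate G {d}. ?F v)"
    using norm by blast
  ultimately show False
    using inf finite_generate_singleton[OF d fin] by (meson finite_UN_I finite_subset)
qed

section \<open>Prime roots of a generator\<close>

lemma commute_int_pow:
  assumes "x \<in> carrier G" "y \<in> carrier G" "x \<otimes> y = y \<otimes> x"
  shows "x [^] (n::int) \<otimes> y = y \<otimes> x [^] n"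
proof -
  have "y \<otimes> x \<otimes> inv y = x"
    using conjugate_eq_iff[of y x x] assms by simp
  then have "y \<otimes> x [^] n \<otimes> inv y = x [^] n"
    using conjugate_int_pow[of y x n] assms by simp
  then show ?thesis
    using conjugate_eq_iff[of y "x [^] n" "x [^] n"] assms by simp
qed

lemma mult_int_pow_distrib:
  assumes "x \<in> carrier G" "y \<in> carrier G" "x \<otimes> y = y \<otimes> x"
  shows "(x [^] (i::int) \<otimes> y [^] (j::int)) [^] (n::int) = x [^] (i * n) \<otimes> y [^] (j * n)"
proof -
  have "x [^] i \<otimes> y = y \<otimes> x [^] i" using assms by (rule commute_int_pow)
  then have "y [^] j \<otimes> x [^] i = x [^] i \<otimes> y [^] j" using assms by (intro commute_int_pow) auto
  then show ?thesis using assms by (simp add: int_pow_mult_distrib int_pow_pow)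
qed

text \<open>A suitable power \<open>z\<close> of \<open>y\<close> lies outside the subgroup
  generated by \<open>d\<close> while \<open>z [^] s\<close> lies inside. Since that subgroup has
  all elements of prime order, \<open>z [^] s\<close> is not an \<open>s\<close>-th power in it, and
  Bezout turns \<open>z\<close> into a root of \<open>d\<close> itself.\<close>

lemma prime_root_of_centralizing:
  assumes d: "d \<in> carrier G" and fin: "ord d \<noteq> 0"
    and prime_mem: "\<And>w. w \<in> carrier G \<Longrightarrow> Factorial_Ring.prime (ord w) \<Longrightarrow> w \<in> generate G {d}"
    and y: "y \<in> carrier G" "ord y \<noteq> 0" "y \<otimes> d = d \<otimes> y" "y \<notin> generate G {d}"
  obtains e s where "e \<in> carrier G" "Factorial_Ring.prime (s::nat)" "e [^] s = d" "s dvd ord d"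
    "e \<notin> generate G {d}"
proof -
  have D: "subgroup (generate G {d}) G" using d by (rule subgroup_generate_singleton)
  define k where "k = (LEAST k. k > 0 \<and> y [^] (k::nat) \<in> generate G {d})"
  have "y [^] ord y \<in> generate G {d}" using y(1) subgroup.one_closed[OF D] by simp
  then have k: "k > 0" "y [^] k \<in> generate G {d}"
    using LeastI[of "\<lambda>k. k > 0 \<and> y [^] (k::nat) \<in> generate G {d}" "ord y"] y(2) unfolding k_def by auto
  have "k \<noteq> 1" using k(2) y by auto
  then obtain s where s: "Factorial_Ring.prime s" "s dvd k" using prime_factor_nat by blast
  then obtain m where m: "k = m * s" by (metis dvd_def mult.commute)
  have "m > 0" "m < k" using m k(1) s prime_gt_1_nat[of s] by auto
  then have not_m: "y [^] m \<notin> generate G {d}"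
    using not_less_Least[of m "\<lambda>k. k > 0 \<and> y [^] (k::nat) \<in> generate G {d}"] unfolding k_def by auto
  define z where "z = y [^] m"
  have z: "z \<in> carrier G" "z \<notin> generate G {d}" "z \<otimes> d = d \<otimes> z"
    using y not_m commute_int_pow[OF y(1) d y(3), of "int m"] by (simp_all add: z_def int_pow_int)
  obtain j :: int where j: "z [^] int s = d [^] j"
    using k(2) mem_generate_singleton[OF d] y(1) m by (auto simp: z_def nat_pow_pow int_pow_int)
  \<comment> \<open>Dividing \<open>z\<close> by such a root would leave an element \<open>w\<close>
    with \<open>w [^] s = \<one>\<close>, hence \<open>w\<close>, and with it \<open>z\<close>, in
    the subgroup.\<close>
  have no_root: "z [^] int s \<noteq> d [^] (i * int s)" for i :: int
  proof
    assume eq: "z [^] int s = d [^] (i * int s)"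
    define w where "w = z [^] (1::int) \<otimes> d [^] (- i)"
    have w: "w \<in> carrier G" using z d by (simp add: w_def)
    have "w [^] int s = z [^] int s \<otimes> d [^] (- i * int s)"
      using mult_int_pow_distrib[OF z(1) d z(3), of 1 "- i" "int s"] by (simp add: w_def)
    also have "\<dots> = d [^] (i * int s + - i * int s)"
      unfolding eq using d by (simp only: int_pow_mult)
    finally have "w [^] s = \<one>" by (simp add: int_pow_int)
    then have "ord w = 1 \<or> ord w = s" using pow_eq_id[OF w] s(1) prime_nat_iff by blast
    then have "w \<in> generate G {d}"
      using prime_mem[OF w] s(1) ord_eq_1[OF w] subgroup.one_closed[OF D] by auto
    moreover have "d [^] i \<in> generate G {d}" using mem_generate_singleton[OF d] by blast
    ultimately have "w \<otimes> d [^] i \<in> generate G {d}" using subgroup.m_closed[OF D] by blast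
    moreover have "w \<otimes> d [^] i = z"
      using z d by (simp add: w_def m_assoc int_pow_mult[symmetric])
    ultimately show False using z(2) by simp
  qed
  have s': "Factorial_Ring.prime (int s)" using s(1) by simp
  \<comment> \<open>Otherwise \<open>s\<close> is invertible modulo \<open>ord d\<close>, and every
    power of \<open>d\<close> has an \<open>s\<close>-th root among the powers of
    \<open>d\<close>.\<close>
  have "s dvd ord d"
  proof (rule ccontr)
    assume "\<not> s dvd ord d"
    then have "coprime (int s) (int (ord d))"
      using s(1) prime_imp_coprime by (metis coprime_int_iff)
    then obtain a b where "a * int s + b * int (ord d) = 1" using bezout_int by (metis coprime_imp_gcd_eq_1)
    then have "j * (a * int s + b * int (ord d)) = j" by simp
    then have "j * a * int s - j = int (ord d) * - (j * b)" by (simp add: algebra_simps)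
    then have "d [^] j = d [^] (j * a * int s)"
      unfolding int_pow_eq[OF d] by (rule dvdI)
    then show False using no_root[of "j * a"] j by simp
  qed
  have "\<not> int s dvd j" using no_root j by (metis dvd_def mult.commute)
  then have "coprime j (int s)" using s' prime_imp_coprime coprime_commute by blast
  then obtain a b where ab: "a * j + b * int s = 1" using bezout_int by (metis coprime_imp_gcd_eq_1)
  \<comment> \<open>With \<open>a * j + b * int s = 1\<close>, the \<open>s\<close>-th power of this
    product is \<open>d [^] (a * j + b * int s)\<close>.\<close>
  define e where "e = z [^] a \<otimes> d [^] b"
  have e: "e \<in> carrier G" using z d by (simp add: e_def)
  have "e [^] int s = z [^] (int s * a) \<otimes> d [^] (b * int s)"
    using mult_int_pow_distrib[OF z(1) d z(3), of a b "int s"] by (simp add: e_def mult.commute)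
  also have "z [^] (int s * a) = d [^] (j * a)"
    using z d j by (simp add: int_pow_pow[symmetric])
  also have "d [^] (j * a) \<otimes> d [^] (b * int s) = d [^] (1::int)"
    using d ab by (simp add: int_pow_mult[symmetric] mult.commute)
  finally have es: "e [^] s = d" using d by (simp add: int_pow_int)
  have "e \<notin> generate G {d}"
  proof
    assume "e \<in> generate G {d}"
    then have "e [^] (1::nat) \<in> generate G {e [^] s}" using e es by simp
    moreover have "s dvd ord e"
    proof -
      have "d [^] ord e = \<one>" using e es by (metis nat_pow_pow mult.commute nat_pow_one pow_ord_eq_1)
      then show ?thesis using \<open>s dvd ord d\<close> pow_eq_id[OF d] dvd_trans by blast
    qed
    ultimately have "s dvd 1" using power_mem_generate_power[OF e] by blast
    then show False using s(1) by simp
  qed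
  then show ?thesis using that e s(1) es \<open>s dvd ord d\<close> by blast
qed

text \<open>Otherwise the subgroups generated by \<open>e\<close>, \<open>e'\<close> and
  \<open>e [^] (s * s)\<close> are the centres of three stars, whose leaves are their subgroups of
  index \<open>t\<close> and \<open>u\<close>. All three stars are joined to the subgroups of index
  \<open>1\<close>, \<open>t\<close>, \<open>u\<close> below the common subgroup generated by
  \<open>e [^] s\<close>.\<close>

lemma planar_group_prime_root_unique:
  assumes pl: "planar_group G"
    and e: "e \<in> carrier G" "e' \<in> carrier G" "ord e \<noteq> 0" "ord e' = ord e"
    and pr: "Factorial_Ring.prime (s::nat)" "Factorial_Ring.prime t" "Factorial_Ring.prime u"
    and ne: "s \<noteq> t" "s \<noteq> u" "t \<noteq> u"
    and dvd: "s * s * t dvd ord e" "s * s * u dvd ord e"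
    and eq: "generate G {e [^] s} = generate G {e' [^] s}"
  shows "e' \<in> generate G {e}"
proof (rule ccontr)
  assume nin: "e' \<notin> generate G {e}"
  let ?E = "subgroup_graph_edges G"
  \<comment> \<open>Index 0 stands for the centre of a star, so its factor is \<open>1\<close>; the
    other two are the primes leading to the leaves.\<close>
  define c where "c j = (if j = 0 then 1 else if j = 1 then t else u)" for j :: nat
  define D where "D k = generate G {e [^] (k::nat)}" for k
  define D' where "D' k = generate G {e' [^] (k::nat)}" for k
  have c_prime: "Factorial_Ring.prime (c j)" if "0 < j" for j
    using that pr by (simp add: c_def)
  have c_inj: "j = l" if "c j = c l" "j < 3" "l < 3" for j l
    using that ne pr by (auto simp: c_def split: if_splits)
  have s_c: "\<not> s dvd c j" for j
    using pr ne primes_dvd_imp_eq[of s t] primes_dvd_imp_eq[of s u] by (auto simp: c_def)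
  have ssc: "s * s * c j dvd ord e" for j
    using dvd dvd_mult_left by (auto simp: c_def)
  have sc: "s * c j dvd ord e" "c j dvd ord e" for j
    using ssc[of j] by (metis dvd_mult_right mult.assoc)+
  have s_pos: "s > 0" using pr(1) prime_gt_0_nat by blast
  have D_eq: "D i = D k \<longleftrightarrow> i = k" if "i dvd ord e" "k dvd ord e" for i k
    using generate_power_eq_iff[OF e(1) that] by (simp add: D_def)
  have D'_eq: "D' i = D' k \<longleftrightarrow> i = k" if "i dvd ord e" "k dvd ord e" for i k
    using generate_power_eq_iff[OF e(2)] that by (simp add: D'_def e(4))
  have pow_incl: "generate G {x [^] k} \<subseteq> generate G {y [^] k}"
    if xy: "x \<in> carrier G" "y \<in> carrier G" "x \<in> generate G {y}" for x y and k :: nat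
  proof -
    obtain i :: int where "x = y [^] i" using xy mem_generate_singleton[OF xy(2)] by auto
    then have "x [^] k = (y [^] k) [^] i"
      using int_pow_pow[OF xy(2), of i "int k"] int_pow_pow[OF xy(2), of "int k" i]
      by (simp add: int_pow_int mult.commute)
    then have "x [^] k \<in> generate G {y [^] k}"
      using mem_generate_singleton[of "y [^] k"] xy(2) by auto
    then show ?thesis
      using generate_singleton_subset_iff[OF subgroup_generate_singleton] xy(2) by simp
  qed
  have DD': "D (s * k) = D' (s * k)" for k
    using pow_incl[of "e [^] s" "e' [^] s" k] pow_incl[of "e' [^] s" "e [^] s" k] eq e
      generate.incl[of "e [^] s" "{e [^] s}" G] generate.incl[of "e' [^] s" "{e' [^] s}" G]
    by (simp add: D_def D'_def nat_pow_pow)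
  have E: "subgroup (generate G {e}) G" using e(1) by (rule subgroup_generate_singleton)
  have D_sub: "D k \<subseteq> generate G {e}" for k
    using generate_singleton_subset_iff[OF E, of "e [^] k"] mem_generate_singleton[OF e(1), of "e [^] k"]
      int_pow_int[of G e k] unfolding D_def by metis
  \<comment> \<open>Equality would place both \<open>e' [^] c j\<close> and \<open>e' [^] s\<close>
    in the subgroup generated by \<open>e\<close>, and these exponents are coprime.\<close>
  have D'_ne: "D' (c j) \<noteq> D k" for j k
  proof
    assume "D' (c j) = D k"
    then have "e' [^] c j \<in> generate G {e}"
      using D_sub[of k] generate.incl[of "e' [^] c j" "{e' [^] c j}" G] by (auto simp: D'_def)
    moreover have "e' [^] s \<in> generate G {e}"
      using D_sub[of s] eq generate.incl[of "e' [^] s" "{e' [^] s}" G] by (auto simp: D_def)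
    moreover have "coprime (c j) s"
      using prime_imp_coprime[OF pr(1) s_c] by (simp add: coprime_commute)
    ultimately show False using coprime_nat_powers_mem[OF E e(2)] nin by blast
  qed
  have edge: "{D k, D (k * l)} \<in> ?E" if "Factorial_Ring.prime l" "k * l dvd ord e" for k l
    using subgroup_graph_edge[OF e(1,3) that] by (simp add: D_def)
  have edge': "{D' k, D' (k * l)} \<in> ?E" if "Factorial_Ring.prime l" "k * l dvd ord e" for k l
    using subgroup_graph_edge[OF e(2) _ that(1), of k] that(2) e by (simp add: D'_def)
  define hub where "hub i j = (if i = 0 then D (c j) else if i = 1 then D' (c j) else D (s * s * c j))"
    for i j :: nat
  show False
  proof (rule planar_graph_three_stars[of "subgroup_graph_vertices G" ?E hub "\<lambda>j. D (s * c j)"])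
    show "planar_graph (subgroup_graph_vertices G) ?E" using pl unfolding planar_group_def .
    show "hub i j \<in> subgroup_graph_vertices G" for i j
      using generate_power_in_vertices e(1,2) by (simp add: hub_def D_def D'_def)
    show "D (s * c j) \<in> subgroup_graph_vertices G" for j
      using generate_power_in_vertices e(1) by (simp add: D_def)
    show "j = l" if "j < 3" "l < 3" "D (s * c j) = D (s * c l)" for j l
      using that D_eq[OF sc(1) sc(1)] s_pos c_inj by simp
    show "hub i j \<noteq> D (s * c l)" for i j l
    proof -
      have "c j \<noteq> s * c l" "s * c j \<noteq> c l" using s_c by (metis dvd_triv_left)+
      then show ?thesis
        using D_eq[OF sc(2) sc(1)] D_eq[OF ssc sc(1)] D'_ne s_pos by (simp add: hub_def mult.assoc)
    qed
    show "i = k \<and> j = l" if "i < 3" "j < 3" "k < 3" "l < 3" "hub i j = hub k l" for i j k l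
    proof -
      have c1: "c a \<noteq> s * s * c b" "s * s * c a \<noteq> c b" for a b
        using s_c by (metis dvd_triv_left mult.assoc)+
      have "D (c a) \<noteq> D (s * s * c b)" "D (s * s * c a) \<noteq> D (c b)" for a b
        using D_eq[OF sc(2) ssc] D_eq[OF ssc sc(2)] c1 by blast+
      moreover have "D k \<noteq> D' (c a)" for k a using D'_ne by metis
      ultimately have "i = k"
        using that D'_ne unfolding hub_def by (auto split: if_splits)
      moreover have "c j = c l"
        using that(5) \<open>i = k\<close> D_eq[OF sc(2) sc(2)] D'_eq[OF sc(2) sc(2)] D_eq[OF ssc ssc] s_pos
        unfolding hub_def by (simp split: if_splits)
      ultimately show ?thesis using c_inj that by simp
    qed
    show "{hub i 0, hub i j} \<in> ?E" if "i < 3" "0 < j" "j < 3" for i j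
      using edge[OF c_prime[OF that(2)], of 1] edge'[OF c_prime[OF that(2)], of 1]
        edge[OF c_prime[OF that(2)], of "s * s"] sc(2)[of j] ssc[of j]
      by (simp add: hub_def c_def[of 0])
    show "{hub i j, D (s * c j)} \<in> ?E" if "i < 3" "j < 3" for i j
    proof -
      have "{D (c j), D (s * c j)} \<in> ?E" "{D' (c j), D (s * c j)} \<in> ?E" "{D (s * s * c j), D (s * c j)} \<in> ?E"
        using edge[OF pr(1), of "c j"] edge'[OF pr(1), of "c j"] edge[OF pr(1), of "s * c j"]
          sc(1)[of j] ssc[of j] DD'[of "c j"]
        by (simp_all add: mult.commute mult.left_commute insert_commute)
      then show ?thesis by (simp add: hub_def)
    qed
  qed
qed

text \<open>One inclusion is given, and conjugate elements have equal order, so the finite subgroups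
  have the same size.\<close>

lemma generate_conjugate_eq:
  assumes d: "d \<in> carrier G" "ord d \<noteq> 0" and g: "g \<in> carrier G"
    and mem: "g \<otimes> d \<otimes> inv g \<in> generate G {d}"
  shows "generate G {g \<otimes> d \<otimes> inv g} = generate G {d}"
proof (rule card_subset_eq)
  show "finite (generate G {d})" using d by (rule finite_generate_singleton)
  show "generate G {g \<otimes> d \<otimes> inv g} \<subseteq> generate G {d}"
    using generate_singleton_subset_iff[OF subgroup_generate_singleton[OF d(1)]] mem by simp
  show "card (generate G {g \<otimes> d \<otimes> inv g}) = card (generate G {d})"
    using generate_pow_card[of d] generate_pow_card[of "g \<otimes> d \<otimes> inv g"] ord_conjugate[OF g d(1)] d(1) g
    by simp
qed

section \<open>Elements whose order is a product of three distinct primes\<close>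

theorem planar_no_element_of_order_pqr:
  assumes inf: "infinite (carrier G)" and pl: "planar_group G"
    and acc: "subgroup_acc G" and dcc: "subgroup_dcc G"
    and x: "x \<in> carrier G"
    and pr: "Factorial_Ring.prime (p::nat)" "Factorial_Ring.prime q" "Factorial_Ring.prime r"
    and ne: "p \<noteq> q" "q \<noteq> r" "p \<noteq> r"
  shows "ord x \<noteq> p * q * r"
proof
  assume ord: "ord x = p * q * r"
  note tors = subgroup_dcc_ord_nonzero[OF dcc]
  have prime_mem: "y \<in> generate G {x}" if "y \<in> carrier G" "Factorial_Ring.prime (ord y)" for y
    using prime_order_mem_generate[OF pl acc dcc x ord pr ne that] .
  have norm_x: "g \<otimes> x \<otimes> inv g \<in> generate G {x}" if g: "g \<in> carrier G" for g
  proof (rule mem_subgroup_if_prime_order_mem[OF subgroup_generate_singleton[OF x] prime_mem _ _ pr ne])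
    show "g \<otimes> x \<otimes> inv g \<in> carrier G" using g x by simp
    show "ord (g \<otimes> x \<otimes> inv g) = p * q * r" using ord_conjugate[OF g x] ord by simp
  qed
  \<comment> \<open>The normal cyclic subgroups above the one generated by \<open>x\<close>; the
    ascending chain condition provides a maximal one.\<close>
  define S where "S = {generate G {d} | d. d \<in> carrier G \<and> x \<in> generate G {d} \<and>
    (\<forall>g \<in> carrier G. g \<otimes> d \<otimes> inv g \<in> generate G {d})}"
  have "generate G {x} \<in> S"
    using x norm_x generate.incl[of x "{x}" G] unfolding S_def by blast
  then obtain M where "M \<in> S"
    and max: "\<forall>U. (U, M) \<in> {(L, K). subgroup L G \<and> subgroup K G \<and> K \<subset> L} \<longrightarrow> U \<notin> S"
    using subgroup_acc_wf[OF acc, unfolded wf_eq_minimal] by (elim allE[of _ S]) blast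
  then obtain d where M: "M = generate G {d}" and d: "d \<in> carrier G" "x \<in> generate G {d}"
    and norm_d: "\<And>g. g \<in> carrier G \<Longrightarrow> g \<otimes> d \<otimes> inv g \<in> generate G {d}"
    unfolding S_def by blast
  have D: "subgroup (generate G {d}) G" using d(1) by (rule subgroup_generate_singleton)
  have x_sub: "generate G {x} \<subseteq> generate G {d}"
    using generate_singleton_subset_iff[OF D] d(2) by simp
  obtain y where y: "y \<in> carrier G" "y \<otimes> d = d \<otimes> y" "y \<notin> generate G {d}"
    using centralizer_not_subset_normal_cyclic[OF inf d(1) tors[OF d(1)] norm_d] by blast
  obtain e s where e: "e \<in> carrier G" "e [^] s = d" "e \<notin> generate G {d}"
    and s: "Factorial_Ring.prime (s::nat)" "s dvd ord d"
    by (rule prime_root_of_centralizing[OF d(1) tors[OF d(1)] _ y(1) tors[OF y(1)] y(2,3)])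
      (use prime_mem x_sub in blast)+
  have De: "subgroup (generate G {e}) G" using e(1) by (rule subgroup_generate_singleton)
  have d_e: "d \<in> generate G {e}"
    using mem_generate_singleton[OF e(1), of d] e(2) int_pow_int[of G e s] by metis
  have sub_e: "generate G {d} \<subseteq> generate G {e}"
    using generate_singleton_subset_iff[OF De] d_e by simp
  \<comment> \<open>If every conjugate of \<open>e\<close> stayed in its cyclic subgroup, that
    subgroup would be a member of \<open>S\<close> strictly above \<open>M\<close>.\<close>
  have "\<exists>g \<in> carrier G. g \<otimes> e \<otimes> inv g \<notin> generate G {e}"
  proof (rule ccontr)
    assume "\<not> ?thesis"
    then have "generate G {e} \<in> S" using e(1) sub_e d(2) unfolding S_def by blast
    moreover have "generate G {d} \<subset> generate G {e}"
      using sub_e e(3) generate.incl[of e "{e}" G] by blast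
    ultimately show False using max De D unfolding M by simp
  qed
  then obtain g where g: "g \<in> carrier G" "g \<otimes> e \<otimes> inv g \<notin> generate G {e}" by blast
  let ?e = "g \<otimes> e \<otimes> inv g"
  have "ord d dvd ord e"
  proof -
    have "d [^] ord e = e [^] (s * ord e)" using e(1) nat_pow_pow[of e s "ord e"] e(2) by simp
    also have "\<dots> = \<one>" using pow_eq_id[OF e(1), of "s * ord e"] by simp
    finally show ?thesis using pow_eq_id[OF d(1)] by simp
  qed
  \<comment> \<open>As \<open>s\<close> divides \<open>ord d\<close>, it divides
    \<open>ord e\<close>, so raising \<open>e\<close> to the power \<open>s\<close> divides its
    order by exactly \<open>s\<close>.\<close>
  then have ord_e: "ord e = s * ord d"
    using dvd_trans[OF s(2)] ord_pow[OF e(1), of s] e(2) prime_gt_0_nat[OF s(1)]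
    by (simp add: dvd_mult_div_cancel)
  have pqr_d: "p * q * r dvd ord d"
  proof -
    obtain i :: int where "x = d [^] i" using d(2) mem_generate_singleton[OF d(1)] by blast
    then have "x [^] int (ord d) = (d [^] int (ord d)) [^] i"
      using d(1) by (simp only: int_pow_pow mult.commute)
    then have "x [^] ord d = \<one>" using d(1) by (simp add: int_pow_int)
    then show ?thesis using pow_eq_id[OF x] ord by simp
  qed
  \<comment> \<open>The conjugate \<open>?e\<close> is an \<open>s\<close>-th root of a conjugate of
    \<open>d\<close>, which generates the same subgroup as \<open>d\<close>. The additional factor
    \<open>s\<close> in \<open>ord e\<close> supplies the square of \<open>s\<close> in the required
    divisors.\<close>
  have root_unique: False
    if "Factorial_Ring.prime t" "Factorial_Ring.prime u" "s \<noteq> t" "s \<noteq> u" "t \<noteq> u" "s * t * u dvd ord d" for t u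
  proof -
    have "?e [^] s = g \<otimes> d \<otimes> inv g" using conjugate_nat_pow[OF g(1) e(1)] e(2) by simp
    then have "generate G {e [^] s} = generate G {?e [^] s}"
      using generate_conjugate_eq[OF d(1) tors[OF d(1)] g(1) norm_d[OF g(1)]] e(2) by simp
    moreover have "s * s * t dvd ord e" "s * s * u dvd ord e"
      using that(6) unfolding ord_e by (metis dvd_mult_left dvd_mult_right mult.assoc mult.commute mult_dvd_mono dvd_refl)+
    ultimately show False
      using planar_group_prime_root_unique[OF pl e(1) _ tors[OF e(1)] ord_conjugate[OF g(1) e(1)] s(1) that(1-5)]
        g e(1) by simp
  qed
  \<comment> \<open>A power of \<open>d\<close> has order \<open>s\<close>, and elements of prime
    order are powers of \<open>x\<close>.\<close>
  have "s dvd p * q * r"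
  proof -
    have fin: "ord d div s \<noteq> 0" using s tors[OF d(1)] by (auto elim!: dvdE)
    let ?w = "d [^] (ord d div s)"
    have "ord ?w = s"
      using ord_pow[OF d(1), of "ord d div s"] fin s by (auto elim!: dvdE)
    then have "?w \<in> generate G {x}" using prime_mem[of ?w] d(1) s(1) by simp
    then obtain i :: int where "?w = x [^] i" using mem_generate_singleton[OF x] by blast
    then have "?w [^] int (ord x) = (x [^] int (ord x)) [^] i"
      using x by (simp only: int_pow_pow mult.commute)
    then have "?w [^] ord x = \<one>" using x by (simp add: int_pow_int)
    then show ?thesis using pow_eq_id[of ?w "ord x"] d(1) \<open>ord ?w = s\<close> ord by simp
  qed
  then have "s = p \<or> s = q \<or> s = r"
    using s(1) pr by (auto simp: prime_dvd_mult_iff dest: primes_dvd_imp_eq)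
  then show False
    using root_unique[of q r] root_unique[of p r] root_unique[of p q] pr ne pqr_d
    by (auto simp: ac_simps)
qed

end

theorem theorem3p2:
  fixes G :: "('a, 'b) monoid_scheme"
  assumes "group G"
    and "infinite (carrier G)"
    and "planar_group G"
    and "subgroup_acc G"
    and "subgroup_dcc G"
  shows "\<not> (\<exists>x p q r. x \<in> carrier G \<and> Factorial_Ring.prime (p::nat) \<and> Factorial_Ring.prime q \<and> Factorial_Ring.prime r \<and>
             p \<noteq> q \<and> q \<noteq> r \<and> p \<noteq> r \<and> group.ord G x = p * q * r)"
  using group.planar_no_element_of_order_pqr[OF assms] by blast

end
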